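(* Let $K$ be a field of prime characteristic $p$, $G$ a finite group, $V$ a finite-dimensional $KG$-module and $r$ a positive integer which is not congruent to $0$ or $-1$ modulo $p$. (i) Suppose that there is a surjective map $\varepsilon: V\to K$ of $KG$-modules. If the map $\partial_r: \operatorname{Sym}^r V \to \operatorname{Sym}^{r-1} V$ splits, then so does the map $\partial_{r+1}: \operatorname{Sym}^{r+1} V \to \operatorname{Sym}^r V$. (ii) Suppose that there is an injective map $\iota: K\to V$ of $KG$-modules. If the map $\eta_{r-1}: \operatorname{Sym}^{r-1} V \to \operatorname{Sym}^r V$ splits, then so does the map $\eta_r: \operatorname{Sym}^r V \to \operatorname{Sym}^{r+1} V$.
   Context: $K$ also denotes the trivial $KG$-module. $\operatorname{Sym} V=\bigoplus_{i\ge 0}\operatorname{Sym}^i V$ is the symmetric algebra of $V$ over $K$ with its natural $G$-action; for a basis $x_1,\dots,x_t$ of $V$ it is identified with the polynomial ring $K[x_1,\dots,x_t]$. Given a surjective $KG$-map $\varepsilon:V\to K$, choose a basis $x_1,\dots,x_t$ of $V$ with $\varepsilon(x_i)=1$ for all $i$, and let $\partial=\sum_{i\le t}\partial/\partial x_i$ on $\operatorname{Sym} V\cong K[x_1,\dots,x_t]$. (Equivalently, $\partial$ is the unique $K$-linear derivation of $\operatorname{Sym}V$ extending $\varepsilon$; it is a $KG$-endomorphism.) For $s\ge 1$, $\partial_s:\operatorname{Sym}^sV\to\operatorname{Sym}^{s-1}V$ is the restriction of $\partial$ to $\operatorname{Sym}^s V$; it is surjective. Given an injective $KG$-map $\iota:K\to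 V$, $\eta:\operatorname{Sym}V\to\operatorname{Sym}V$ is multiplication by $\iota(1)\in V=\operatorname{Sym}^1V$. For $s\ge 0$, $\eta_s:\operatorname{Sym}^sV\to\operatorname{Sym}^{s+1}V$ is the restriction of $\eta$ to $\operatorname{Sym}^s V$; it is injective. A surjective $KG$-map $f$ splits if there is a $KG$-map $g$ with $f\circ g=\operatorname{id}$; an injective $KG$-map $f$ splits if there is a $KG$-map $g$ with $g\circ f=\operatorname{id}$. *)

theory Defs
  imports
    Complex_Main
    "HOL-Algebra.Group"
    "HOL-Library.Poly_Mapping"
    "HOL-Number_Theory.Cong"
begin

section \<open>Modules over a group algebra\<close>

text \<open>The ground field is a type \<open>'k\<close>. The carrier of a module is a linear subspace of an
  ambient \<open>'k\<close>-vector space \<open>'a\<close>; nothing is assumed about \<open>act\<close> outside it. This allows the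
  symmetric powers below to be modules inside one polynomial ring.\<close>

record ('g, 'k, 'a) kG_structure = "'a partial_object" +
  scal :: "'k \<Rightarrow> 'a \<Rightarrow> 'a"
  act :: "'g \<Rightarrow> 'a \<Rightarrow> 'a"

definition kG_module ::
  "('g, 'x) monoid_scheme \<Rightarrow> ('g, 'k::field, 'a::ab_group_add) kG_structure \<Rightarrow> bool" where
  "kG_module G M \<longleftrightarrow>
     group G \<and> vector_space (scal M) \<and> module.subspace (scal M) (carrier M) \<and>
     (\<forall>g\<in>carrier G. \<forall>x\<in>carrier M. act M g x \<in> carrier M) \<and>
     (\<forall>g\<in>carrier G. \<forall>x\<in>carrier M. \<forall>y\<in>carrier M. act M g (x + y) = act M g x + act M g y) \<and>
     (\<forall>g\<in>carrier G. \<forall>c. \<forall>x\<in>carrier M. act M g (scal M c x) = scal M c (act M g x)) \<and>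
     (\<forall>x\<in>carrier M. act M \<one>\<^bsub>G\<^esub> x = x) \<and>
     (\<forall>g\<in>carrier G. \<forall>h\<in>carrier G. \<forall>x\<in>carrier M. act M (g \<otimes>\<^bsub>G\<^esub> h) x = act M g (act M h x))"

definition is_basis :: "('g, 'k::field, 'a::ab_group_add) kG_structure \<Rightarrow> 'a set \<Rightarrow> bool" where
  "is_basis M B \<longleftrightarrow> B \<subseteq> carrier M \<and> \<not> module.dependent (scal M) B \<and> module.span (scal M) B = carrier M"

definition fin_dim :: "('g, 'k::field, 'a::ab_group_add) kG_structure \<Rightarrow> bool" where
  "fin_dim M \<longleftrightarrow> (\<exists>B. finite B \<and> is_basis M B)"

definition trivial_module :: "('g, 'k::field, 'k) kG_structure" where
  "trivial_module = \<lparr>carrier = UNIV, scal = (*), act = (\<lambda>g c. c)\<rparr>"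

definition kG_hom ::
  "('g, 'x) monoid_scheme \<Rightarrow> ('g, 'k::field, 'a::ab_group_add) kG_structure \<Rightarrow>
   ('g, 'k, 'b::ab_group_add) kG_structure \<Rightarrow> ('a \<Rightarrow> 'b) \<Rightarrow> bool" where
  "kG_hom G M N f \<longleftrightarrow>
     (\<forall>x\<in>carrier M. f x \<in> carrier N) \<and>
     (\<forall>x\<in>carrier M. \<forall>y\<in>carrier M. f (x + y) = f x + f y) \<and>
     (\<forall>c. \<forall>x\<in>carrier M. f (scal M c x) = scal N c (f x)) \<and>
     (\<forall>g\<in>carrier G. \<forall>x\<in>carrier M. f (act M g x) = act N g (f x))"

definition splits_surj ::
  "('g, 'x) monoid_scheme \<Rightarrow> ('g, 'k::field, 'a::ab_group_add) kG_structure \<Rightarrow>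
   ('g, 'k, 'b::ab_group_add) kG_structure \<Rightarrow> ('a \<Rightarrow> 'b) \<Rightarrow> bool" where
  "splits_surj G M N f \<longleftrightarrow> (\<exists>g. kG_hom G N M g \<and> (\<forall>y\<in>carrier N. f (g y) = y))"

definition splits_inj ::
  "('g, 'x) monoid_scheme \<Rightarrow> ('g, 'k::field, 'a::ab_group_add) kG_structure \<Rightarrow>
   ('g, 'k, 'b::ab_group_add) kG_structure \<Rightarrow> ('a \<Rightarrow> 'b) \<Rightarrow> bool" where
  "splits_inj G M N f \<longleftrightarrow> (\<exists>g. kG_hom G N M g \<and> (\<forall>x\<in>carrier M. g (f x) = x))"


section \<open>The symmetric algebra as a polynomial ring on a basis\<close>

text \<open>For a basis \<open>B\<close> of \<open>V\<close>, \<open>Sym V\<close> is the polynomial ring over \<open>'k\<close> in the variables \<open>B\<close>.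
  The type below has a variable for every element of \<open>'v\<close>; only those in \<open>B\<close> are used.\<close>

type_synonym ('v, 'k) mpoly = "('v \<Rightarrow>\<^sub>0 nat) \<Rightarrow>\<^sub>0 'k"

definition mconst :: "'k::field \<Rightarrow> ('v, 'k) mpoly" where
  "mconst c = Poly_Mapping.single 0 c"

definition mvar :: "'v \<Rightarrow> ('v, 'k::field) mpoly" where
  "mvar b = Poly_Mapping.single (Poly_Mapping.single b 1) 1"

definition mono_degree :: "('v \<Rightarrow>\<^sub>0 nat) \<Rightarrow> nat" where
  "mono_degree m = (\<Sum>b\<in>Poly_Mapping.keys m. Poly_Mapping.lookup m b)"

text \<open>The polynomial obtained by replacing every variable \<open>b\<close> by \<open>\<sigma> b\<close>.\<close>

definition msubst :: "('v \<Rightarrow> ('v, 'k::field) mpoly) \<Rightarrow> ('v, 'k) mpoly \<Rightarrow> ('v, 'k) mpoly" where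
  "msubst \<sigma> q = (\<Sum>m\<in>Poly_Mapping.keys q.
      mconst (Poly_Mapping.lookup q m) *
      (\<Prod>b\<in>Poly_Mapping.keys m. \<sigma> b ^ Poly_Mapping.lookup m b))"

text \<open>The formal partial derivative. Exponent subtraction truncates, but only where the
  coefficient vanishes.\<close>

definition mpderiv :: "'v \<Rightarrow> ('v, 'k::field) mpoly \<Rightarrow> ('v, 'k) mpoly" where
  "mpderiv b q = (\<Sum>m\<in>Poly_Mapping.keys q.
      Poly_Mapping.single (m - Poly_Mapping.single b 1)
        (of_nat (Poly_Mapping.lookup m b) * Poly_Mapping.lookup q m))"

text \<open>The inclusion of \<open>V = Sym\<^sup>1 V\<close> into \<open>Sym V\<close>.\<close>

definition sym_incl ::
  "('g, 'k::field, 'v::ab_group_add) kG_structure \<Rightarrow> 'v set \<Rightarrow> 'v \<Rightarrow> ('v, 'k) mpoly" where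
  "sym_incl V B v = (\<Sum>b\<in>B. mconst (module.representation (scal V) B v b) * mvar b)"

text \<open>The \<open>s\<close>-th symmetric power; a group element acts as the algebra endomorphism
  that extends its action on \<open>V\<close>.\<close>

definition Sym_pow ::
  "('g, 'k::field, 'v::ab_group_add) kG_structure \<Rightarrow> 'v set \<Rightarrow> nat \<Rightarrow>
   ('g, 'k, ('v, 'k) mpoly) kG_structure" where
  "Sym_pow V B s =
     \<lparr>carrier = {q. \<forall>m\<in>Poly_Mapping.keys q. Poly_Mapping.keys m \<subseteq> B \<and> mono_degree m = s},
      scal = (\<lambda>c q. mconst c * q),
      act = (\<lambda>g. msubst (\<lambda>b. sym_incl V B (act V g b)))\<rparr>"

text \<open>For a basis \<open>B\<close> on which \<open>\<epsilon>\<close> is constantly \<open>1\<close>, this is the derivation of \<open>Sym V\<close>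
  that extends \<open>\<epsilon>\<close>.\<close>

definition sym_partial :: "'v set \<Rightarrow> ('v, 'k::field) mpoly \<Rightarrow> ('v, 'k) mpoly" where
  "sym_partial B q = (\<Sum>b\<in>B. mpderiv b q)"

definition sym_eta ::
  "('g, 'k::field, 'v::ab_group_add) kG_structure \<Rightarrow> 'v set \<Rightarrow> ('k \<Rightarrow> 'v) \<Rightarrow>
   ('v, 'k) mpoly \<Rightarrow> ('v, 'k) mpoly" where
  "sym_eta V B \<iota> q = sym_incl V B (\<iota> 1) * q"

end

theory Submission
  imports Defs
begin

text \<open>For a homomorphism \<open>\<phi>\<close> between symmetric powers, \<open>\<tau> f = (\<Sum>b. x\<^sub>b \<phi> (\<partial>f/\<partial>x\<^sub>b))\<close> is again
  a homomorphism, by the chain rule; it is comultiplication \<open>Sym\<^sup>s\<^sup>+\<^sup>1 V \<rightarrow> V \<otimes> Sym\<^sup>s V\<close>, then \<open>\<phi>\<close> on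
  the second factor, then multiplication. If \<open>\<phi>\<close> is a section \<open>\<sigma>\<close> of \<open>\<partial>\<^sub>r\<close>, the Leibniz rule and
  Euler's identity give \<open>\<partial>\<tau> = r + \<sigma>\<partial>\<close> on \<open>Sym\<^sup>r V\<close>; if \<open>\<phi>\<close> is a retraction \<open>\<rho>\<close> of \<open>\<eta>\<^sub>r\<^sub>-\<^sub>1\<close>, they
  give \<open>\<tau>\<eta> = r + \<eta>\<rho>\<close>. Since \<open>e = \<sigma>\<partial>\<close>, respectively \<open>e = \<eta>\<rho>\<close>, is idempotent, \<open>r + e\<close> has the
  inverse \<open>(1 - e / (r + 1)) / r\<close> as soon as \<open>r\<close> and \<open>r + 1\<close> are nonzero in the field.\<close>

section \<open>Polynomials in the variables of a set\<close>

text \<open>A finitely supported function is the sum of its one-point parts. The set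
  \<open>S\<close> serves two uses: on polynomials it restricts the monomials, on exponents it
  restricts the variables.\<close>

lemma poly_mapping_induct_single [consumes 1, case_names zero single add]:
  fixes q :: "'a \<Rightarrow>\<^sub>0 'b::comm_monoid_add"
  assumes "Poly_Mapping.keys q \<subseteq> S"
    and "P 0"
    and "\<And>m c. m \<in> S \<Longrightarrow> P (Poly_Mapping.single m c)"
    and "\<And>p q. P p \<Longrightarrow> P q \<Longrightarrow> P (p + q)"
  shows "P q"
proof -
  have "finite A \<Longrightarrow> A \<subseteq> S \<Longrightarrow> P (\<Sum>m\<in>A. Poly_Mapping.single m (Poly_Mapping.lookup q m))" for A
    by (induction A rule: finite_induct) (auto intro: assms)
  moreover have "(\<Sum>m\<in>Poly_Mapping.keys q. Poly_Mapping.single m (Poly_Mapping.lookup q m)) = q"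
    by (rule poly_mapping_eqI)
      (auto simp: lookup_sum lookup_single when_def in_keys_iff)
  ultimately show ?thesis
    using assms(1) finite_keys by metis
qed

lemma mconst_mult_single: "mconst c * Poly_Mapping.single m d = Poly_Mapping.single m (c * d)"
  by (simp add: mconst_def mult_single)

lemma mconst_0 [simp]: "mconst 0 = 0"
  by (simp add: mconst_def)

lemma mconst_1 [simp]: "mconst 1 = 1"
  by (simp add: mconst_def)

lemma mconst_add: "mconst (a + b) = mconst a + mconst b"
  by (simp add: mconst_def single_add)

lemma mconst_mult: "mconst (a * b) = mconst a * mconst b"
  by (simp add: mconst_def mult_single)

lemma mconst_sum: "mconst (sum f A) = (\<Sum>a\<in>A. mconst (f a))"
  by (induction A rule: infinite_finite_induct) (auto simp: mconst_add)

lemma mconst_of_nat: "mconst (of_nat n) = of_nat n"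
  by (induction n) (simp_all add: mconst_add)

text \<open>Constants and the variables from \<open>B\<close> generate the polynomial ring on
  \<open>B\<close>, so a property closed under sums and products can be tested on them.\<close>

lemma mpoly_induct [consumes 1, case_names const var add mult]:
  fixes q :: "('v, 'k::field) mpoly"
  assumes "\<forall>m\<in>Poly_Mapping.keys q. Poly_Mapping.keys m \<subseteq> B"
    and const: "\<And>c. P (mconst c)"
    and var: "\<And>b. b \<in> B \<Longrightarrow> P (mvar b)"
    and add: "\<And>p q. P p \<Longrightarrow> P q \<Longrightarrow> P (p + q)"
    and mult: "\<And>p q. P p \<Longrightarrow> P q \<Longrightarrow> P (p * q)"
  shows "P q"
proof -
  have one: "P 1"
    using const[of 1] by simp
  have pow: "P (Poly_Mapping.single (Poly_Mapping.single b n) 1)" if "b \<in> B" for b n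
  proof (induction n)
    case (Suc n)
    have "Poly_Mapping.single (Poly_Mapping.single b (Suc n)) 1
      = mvar b * Poly_Mapping.single (Poly_Mapping.single b n) (1::'k)"
      unfolding mvar_def mult_single single_add[symmetric] by simp
    then show ?case
      using Suc var[OF that] mult by metis
  qed (use one in simp)
  have add_mono: "Poly_Mapping.single (m + n) (1::'k)
      = Poly_Mapping.single m 1 * Poly_Mapping.single n 1" for m n :: "'v \<Rightarrow>\<^sub>0 nat"
    by (simp add: mult_single)
  \<comment> \<open>An exponent is itself a finitely supported function, so the same induction
    splits it into powers of single variables, and sums of exponents become products.\<close>
  have mono: "P (Poly_Mapping.single m 1)" if "Poly_Mapping.keys m \<subseteq> B" for m
    using that by (induction m rule: poly_mapping_induct_single) (auto intro: mult pow simp: one add_mono)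
  have "Poly_Mapping.single m c = mconst c * Poly_Mapping.single m 1" for m and c :: 'k
    by (simp add: mconst_mult_single)
  then have single: "P (Poly_Mapping.single m c)" if "Poly_Mapping.keys m \<subseteq> B" for m c
    using that mono const mult by metis
  have "Poly_Mapping.keys q \<subseteq> {m. Poly_Mapping.keys m \<subseteq> B}"
    using assms(1) by auto
  then show ?thesis
    using const[of 0] by (induction q rule: poly_mapping_induct_single) (auto intro: add single)
qed

section \<open>Substitution as an algebra endomorphism\<close>

lemma msubst_alt:
  assumes "finite A" "Poly_Mapping.keys q \<subseteq> A"
  shows "msubst \<sigma> q = (\<Sum>m\<in>A. mconst (Poly_Mapping.lookup q m) *
      (\<Prod>b\<in>Poly_Mapping.keys m. \<sigma> b ^ Poly_Mapping.lookup m b))"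
  unfolding msubst_def using assms
  by (intro sum.mono_neutral_left) (auto simp: in_keys_iff)

lemma msubst_zero [simp]: "msubst \<sigma> 0 = 0"
  by (simp add: msubst_def)

text \<open>The supports of \<open>p\<close>, \<open>q\<close> and \<open>p + q\<close> may differ;
  all three sums are taken over one finite set, the extra terms being zero.\<close>

lemma msubst_add: "msubst \<sigma> (p + q) = msubst \<sigma> p + msubst \<sigma> q"
proof -
  let ?A = "Poly_Mapping.keys p \<union> Poly_Mapping.keys q"
  have "Poly_Mapping.keys (p + q) \<subseteq> ?A" "finite ?A"
    by (auto simp: in_keys_iff lookup_add)
  then show ?thesis
    by (simp add: msubst_alt[of ?A] lookup_add mconst_add distrib_right sum.distrib)
qed

lemma msubst_single:
  "msubst \<sigma> (Poly_Mapping.single m c)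
    = mconst c * (\<Prod>b\<in>Poly_Mapping.keys m. \<sigma> b ^ Poly_Mapping.lookup m b)"
  by (subst msubst_alt[of "{m}"]) auto

text \<open>On monomials this is the addition of exponents. Both sides are additive in each factor,
  so inductions on \<open>p\<close> and then on \<open>q\<close> give the general case.\<close>

lemma msubst_mult: "msubst \<sigma> (p * q) = msubst \<sigma> p * msubst \<sigma> q"
proof -
  \<comment> \<open>Padding with zeroth powers permits one index set for \<open>m\<close>,
    \<open>n\<close> and \<open>m + n\<close>.\<close>
  have alt: "(\<Prod>b\<in>Poly_Mapping.keys m. \<sigma> b ^ Poly_Mapping.lookup m b)
      = (\<Prod>b\<in>A. \<sigma> b ^ Poly_Mapping.lookup m b)"
    if "finite A" "Poly_Mapping.keys m \<subseteq> A" for A and m :: "'a \<Rightarrow>\<^sub>0 nat"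
    using that by (intro prod.mono_neutral_left) (auto simp: in_keys_iff)
  have "(\<Prod>b\<in>Poly_Mapping.keys (m + n). \<sigma> b ^ Poly_Mapping.lookup (m + n) b)
      = (\<Prod>b\<in>Poly_Mapping.keys m. \<sigma> b ^ Poly_Mapping.lookup m b) *
        (\<Prod>b\<in>Poly_Mapping.keys n. \<sigma> b ^ Poly_Mapping.lookup n b)" for m n :: "'a \<Rightarrow>\<^sub>0 nat"
  proof -
    let ?A = "Poly_Mapping.keys m \<union> Poly_Mapping.keys n"
    have "Poly_Mapping.keys (m + n) \<subseteq> ?A" "Poly_Mapping.keys m \<subseteq> ?A"
      "Poly_Mapping.keys n \<subseteq> ?A" and fin: "finite ?A"
      by (auto simp: in_keys_iff lookup_add)
    from this(1-3)[THEN alt[OF fin]] show ?thesis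
      by (simp only: lookup_add power_add prod.distrib)
  qed
  then have single: "msubst \<sigma> (Poly_Mapping.single m c * Poly_Mapping.single n d)
      = msubst \<sigma> (Poly_Mapping.single m c) * msubst \<sigma> (Poly_Mapping.single n d)" for m n c d
    by (simp add: mult_single msubst_single mconst_mult)
  have right: "msubst \<sigma> (p * Poly_Mapping.single n d) = msubst \<sigma> p * msubst \<sigma> (Poly_Mapping.single n d)" for n d
    using subset_UNIV[of "Poly_Mapping.keys p"]
    by (induction p rule: poly_mapping_induct_single) (simp_all add: single msubst_add distrib_right)
  show ?thesis
    using subset_UNIV[of "Poly_Mapping.keys q"]
    by (induction q rule: poly_mapping_induct_single) (simp_all add: right msubst_add distrib_left)
qed

lemma msubst_mconst [simp]: "msubst \<sigma> (mconst c) = mconst c"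
  unfolding mconst_def by (simp add: msubst_single) (simp add: mconst_def)

lemma msubst_one [simp]: "msubst \<sigma> 1 = 1"
  using msubst_mconst[of \<sigma> 1] by simp

lemma msubst_mvar [simp]: "msubst \<sigma> (mvar b) = \<sigma> b"
  by (simp add: mvar_def msubst_single)

lemma msubst_sum: "msubst \<sigma> (sum f A) = (\<Sum>a\<in>A. msubst \<sigma> (f a))"
  by (induction A rule: infinite_finite_induct) (auto simp: msubst_add)

section \<open>Formal partial derivatives: Leibniz rule and chain rule\<close>

lemma mpderiv_alt:
  assumes "finite A" "Poly_Mapping.keys q \<subseteq> A"
  shows "mpderiv b q = (\<Sum>m\<in>A. Poly_Mapping.single (m - Poly_Mapping.single b 1)
        (of_nat (Poly_Mapping.lookup m b) * Poly_Mapping.lookup q m))"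
  unfolding mpderiv_def using assms
  by (intro sum.mono_neutral_left) (auto simp: in_keys_iff)

lemma mpderiv_zero [simp]: "mpderiv b 0 = 0"
  by (simp add: mpderiv_def)

lemma mpderiv_add: "mpderiv b (p + q) = mpderiv b p + mpderiv b q"
proof -
  let ?A = "Poly_Mapping.keys p \<union> Poly_Mapping.keys q"
  have "Poly_Mapping.keys (p + q) \<subseteq> ?A" "finite ?A"
    by (auto simp: in_keys_iff lookup_add)
  then show ?thesis
    by (simp add: mpderiv_alt[of ?A] lookup_add distrib_left single_add sum.distrib)
qed

lemma mpderiv_single:
  "mpderiv b (Poly_Mapping.single m c) =
    Poly_Mapping.single (m - Poly_Mapping.single b 1) (of_nat (Poly_Mapping.lookup m b) * c)"
  by (subst mpderiv_alt[of "{m}"]) auto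

lemma mpderiv_sum: "mpderiv b (sum f A) = (\<Sum>a\<in>A. mpderiv b (f a))"
  by (induction A rule: infinite_finite_induct) (auto simp: mpderiv_add)

text \<open>Subtraction of exponents truncates at zero; the positive exponent of \<open>b\<close> in
  \<open>m\<close> makes it exact on both sides.\<close>

lemma minus_single_add:
  fixes m n :: "'v \<Rightarrow>\<^sub>0 nat"
  assumes "Poly_Mapping.lookup m b \<noteq> 0"
  shows "(m - Poly_Mapping.single b 1) + n = (m + n) - Poly_Mapping.single b 1"
  using assms by (intro poly_mapping_eqI)
    (auto simp: lookup_add lookup_minus lookup_single when_def)

lemma mpderiv_mult: "mpderiv b (p * q) = mpderiv b p * q + p * mpderiv b q"
proof -
  have single: "mpderiv b (Poly_Mapping.single m c * Poly_Mapping.single n d)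
      = mpderiv b (Poly_Mapping.single m c) * Poly_Mapping.single n d
        + Poly_Mapping.single m c * mpderiv b (Poly_Mapping.single n d)" for m n c d
  proof -
    \<comment> \<open>When \<open>b\<close> is absent from \<open>m\<close>, truncation may make the
      two exponents disagree, but the coefficient is then zero.\<close>
    have 1: "Poly_Mapping.single ((m - Poly_Mapping.single b 1) + n) (of_nat (Poly_Mapping.lookup m b) * c * d)
      = Poly_Mapping.single ((m + n) - Poly_Mapping.single b 1) (of_nat (Poly_Mapping.lookup m b) * c * d)"
      using minus_single_add[of m b n] by (cases "Poly_Mapping.lookup m b = 0") auto
    have 2: "Poly_Mapping.single (m + (n - Poly_Mapping.single b 1)) (c * (of_nat (Poly_Mapping.lookup n b) * d))
      = Poly_Mapping.single ((m + n) - Poly_Mapping.single b 1) (c * (of_nat (Poly_Mapping.lookup n b) * d))"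
      using minus_single_add[of n b m] by (cases "Poly_Mapping.lookup n b = 0") (auto simp: add.commute)
    show ?thesis
      unfolding mult_single mpderiv_single 1 2
      by (simp add: lookup_add algebra_simps flip: single_add)
  qed
  have right: "mpderiv b (p * Poly_Mapping.single n d)
      = mpderiv b p * Poly_Mapping.single n d + p * mpderiv b (Poly_Mapping.single n d)" for n d
    using subset_UNIV[of "Poly_Mapping.keys p"]
    by (induction p rule: poly_mapping_induct_single) (simp_all add: single mpderiv_add algebra_simps)
  show ?thesis
    using subset_UNIV[of "Poly_Mapping.keys q"]
    by (induction q rule: poly_mapping_induct_single) (simp_all add: right mpderiv_add algebra_simps)
qed

lemma mpderiv_mconst [simp]: "mpderiv b (mconst c) = 0"
  by (simp add: mconst_def mpderiv_single)

lemma mpderiv_mvar: "mpderiv b (mvar a) = (if a = b then 1 else 0)"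
  by (simp add: mvar_def mpderiv_single lookup_single when_def)

text \<open>Chain rule. Writing \<open>D\<close> for either side as a map of \<open>q\<close>, both
  satisfy \<open>D (p * q) = D p * msubst \<sigma> q + msubst \<sigma> p * D q\<close>, so it
  suffices to compare them on constants and variables.\<close>

lemma mpderiv_msubst:
  assumes "finite B" and "\<forall>m\<in>Poly_Mapping.keys q. Poly_Mapping.keys m \<subseteq> B"
  shows "mpderiv i (msubst \<sigma> q) = (\<Sum>j\<in>B. mpderiv i (\<sigma> j) * msubst \<sigma> (mpderiv j q))"
  using assms(2)
proof (induction q rule: mpoly_induct)
  case (var b)
  then show ?case
    using assms(1) by (simp add: mpderiv_mvar if_distrib[of "msubst \<sigma>"] if_distrib[of "(*) _"] cong: if_cong)
qed (simp_all add: msubst_add msubst_mult mpderiv_add mpderiv_mult algebra_simps sum.distrib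
   sum_distrib_left)

section \<open>Homogeneous polynomials\<close>

text \<open>The carrier of \<open>Sym_pow V B s\<close>; it depends on \<open>B\<close> and
  \<open>s\<close> alone, so degree arguments can be made without a module.\<close>

definition homog :: "'v set \<Rightarrow> nat \<Rightarrow> ('v, 'k::field) mpoly set" where
  "homog B s = {q. \<forall>m\<in>Poly_Mapping.keys q. Poly_Mapping.keys m \<subseteq> B \<and> mono_degree m = s}"

lemma homog_zero [simp]: "0 \<in> homog B s"
  by (simp add: homog_def)

lemma homog_add: "p \<in> homog B s \<Longrightarrow> q \<in> homog B s \<Longrightarrow> p + q \<in> homog B s"
  using keys_add[of p q] unfolding homog_def by blast

lemma homog_sum: "(\<And>a. a \<in> A \<Longrightarrow> f a \<in> homog B s) \<Longrightarrow> sum f A \<in> homog B s"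
  by (induction A rule: infinite_finite_induct) (auto intro: homog_add)

lemma homog_single:
  "Poly_Mapping.keys m \<subseteq> B \<Longrightarrow> mono_degree m = s \<Longrightarrow> Poly_Mapping.single m c \<in> homog B s"
  by (simp add: homog_def)

lemma homog_induct [consumes 1, case_names zero single add]:
  assumes "q \<in> homog B s" "P 0"
    and "\<And>m c. Poly_Mapping.keys m \<subseteq> B \<Longrightarrow> mono_degree m = s \<Longrightarrow> P (Poly_Mapping.single m c)"
    and "\<And>p q. P p \<Longrightarrow> P q \<Longrightarrow> P (p + q)"
  shows "P q"
proof -
  have "Poly_Mapping.keys q \<subseteq> {m. Poly_Mapping.keys m \<subseteq> B \<and> mono_degree m = s}"
    using assms(1) by (auto simp: homog_def)
  then show ?thesis
    by (induction q rule: poly_mapping_induct_single) (auto intro: assms)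
qed

lemma mono_degree_alt:
  "finite A \<Longrightarrow> Poly_Mapping.keys m \<subseteq> A \<Longrightarrow> mono_degree m = (\<Sum>b\<in>A. Poly_Mapping.lookup m b)"
  unfolding mono_degree_def by (intro sum.mono_neutral_left) (auto simp: in_keys_iff)

lemma mono_degree_add: "mono_degree (m + n) = mono_degree m + mono_degree n"
proof -
  let ?A = "Poly_Mapping.keys m \<union> Poly_Mapping.keys n"
  have "Poly_Mapping.keys (m + n) \<subseteq> ?A" "finite ?A"
    by (auto simp: in_keys_iff lookup_add)
  then show ?thesis
    by (simp add: mono_degree_alt[of ?A] lookup_add sum.distrib)
qed

lemma homog_mult:
  assumes "p \<in> homog B s" "q \<in> homog B t"
  shows "p * q \<in> homog B (s + t)"
proof -
  have "Poly_Mapping.keys x \<subseteq> B \<and> mono_degree x = s + t" if x: "x \<in> Poly_Mapping.keys (p * q)" for x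
  proof -
    obtain m n where mn: "x = m + n" "m \<in> Poly_Mapping.keys p" "n \<in> Poly_Mapping.keys q"
      using keys_mult[of p q] x by blast
    then show ?thesis
      using assms keys_add[of m n] by (fastforce simp: homog_def mono_degree_add)
  qed
  then show ?thesis
    by (simp add: homog_def)
qed

lemma homog_mconst: "mconst c \<in> homog B 0"
  unfolding mconst_def by (rule homog_single) (auto simp: mono_degree_def)

lemma homog_scale: "q \<in> homog B s \<Longrightarrow> mconst c * q \<in> homog B s"
  using homog_mult[OF homog_mconst, of q B s c] by simp

lemma homog_mvar: "b \<in> B \<Longrightarrow> mvar b \<in> homog B 1"
  unfolding mvar_def by (rule homog_single) (auto simp: mono_degree_def)

lemma homog_power: "p \<in> homog B s \<Longrightarrow> p ^ n \<in> homog B (n * s)"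
proof (induction n)
  case 0
  show ?case
    using homog_mconst[of 1 B] by simp
next
  case (Suc n)
  then show ?case
    using homog_mult[of p B s "p ^ n" "n * s"] by simp
qed

lemma homog_prod:
  "(\<And>a. a \<in> A \<Longrightarrow> f a \<in> homog B (d a)) \<Longrightarrow> prod f A \<in> homog B (sum d A)"
proof (induction A rule: infinite_finite_induct)
  case (insert a A)
  then show ?case
    using homog_mult[of "f a" B "d a" "prod f A" "sum d A"] by simp
qed (use homog_mconst[of 1 B] in simp_all)

text \<open>A monomial of degree \<open>s\<close> becomes a product of \<open>s\<close> linear
  forms. This keeps the group action inside each symmetric power.\<close>

lemma homog_msubst:
  assumes q: "q \<in> homog B s" and \<sigma>: "\<And>b. b \<in> B \<Longrightarrow> \<sigma> b \<in> homog B 1"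
  shows "msubst \<sigma> q \<in> homog B s"
  unfolding msubst_def
proof (intro homog_sum homog_scale)
  fix m assume m: "m \<in> Poly_Mapping.keys q"
  then have "\<sigma> b ^ Poly_Mapping.lookup m b \<in> homog B (Poly_Mapping.lookup m b)"
    if "b \<in> Poly_Mapping.keys m" for b
    using that q homog_power[OF \<sigma>, of b "Poly_Mapping.lookup m b"] by (auto simp: homog_def)
  then show "(\<Prod>b\<in>Poly_Mapping.keys m. \<sigma> b ^ Poly_Mapping.lookup m b) \<in> homog B s"
    using homog_prod[of "Poly_Mapping.keys m" "\<lambda>b. \<sigma> b ^ Poly_Mapping.lookup m b" B "Poly_Mapping.lookup m"]
      m q by (auto simp: homog_def mono_degree_def)
qed

text \<open>A monomial without \<open>b\<close> has derivative zero, which lies in every degree;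
  otherwise exactly one factor \<open>b\<close> is removed.\<close>

lemma homog_mpderiv:
  assumes "q \<in> homog B (Suc s)"
  shows "mpderiv b q \<in> homog B s"
  using assms
proof (induction q rule: homog_induct)
  case (single m c)
  show ?case
  proof (cases "Poly_Mapping.lookup m b = 0")
    case False
    let ?n = "m - Poly_Mapping.single b 1"
    have "?n + Poly_Mapping.single b 1 = m"
      using minus_single_add[OF False, of "Poly_Mapping.single b 1"] by simp
    then have "mono_degree m = mono_degree ?n + 1"
      using mono_degree_add[of ?n "Poly_Mapping.single b 1"] by (simp add: mono_degree_def)
    moreover have "Poly_Mapping.keys ?n \<subseteq> Poly_Mapping.keys m"
      by (auto simp: in_keys_iff lookup_minus)
    ultimately show ?thesis
      using single unfolding mpderiv_single by (intro homog_single) auto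
  qed (simp add: mpderiv_single)
qed (auto simp: mpderiv_add intro: homog_add)

text \<open>On a monomial, the summand for \<open>b\<close> is multiplication by the exponent of
  \<open>b\<close>, and these exponents add up to \<open>s\<close>.\<close>

lemma euler_homogeneous:
  assumes "finite B" "q \<in> homog B s"
  shows "(\<Sum>b\<in>B. mvar b * mpderiv b q) = of_nat s * q"
  using assms(2)
proof (induction q rule: homog_induct)
  case (single m c)
  have "mvar b * mpderiv b (Poly_Mapping.single m c)
      = of_nat (Poly_Mapping.lookup m b) * Poly_Mapping.single m c" for b
  proof (cases "Poly_Mapping.lookup m b = 0")
    case False
    then show ?thesis
      using minus_single_add[OF False, of "Poly_Mapping.single b 1"]
      by (simp add: mvar_def mpderiv_single mult_single add.commute mconst_mult_single flip: mconst_of_nat)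
  qed (simp add: mpderiv_single)
  then show ?case
    using single assms(1) by (auto simp: mono_degree_alt[of B] simp flip: sum_distrib_right)
qed (simp_all add: mpderiv_add distrib_left sum.distrib)

section \<open>Homomorphisms between symmetric powers\<close>

text \<open>Module maps are additive only on their carrier, so the induction also records that every
  partial sum stays in \<open>C\<close>.\<close>

lemma additive_on_sum:
  assumes "f 0 = 0" "0 \<in> C" "\<And>x y. x \<in> C \<Longrightarrow> y \<in> C \<Longrightarrow> x + y \<in> C"
    and "\<And>x y. x \<in> C \<Longrightarrow> y \<in> C \<Longrightarrow> f (x + y) = f x + f y"
    and "\<And>i. i \<in> I \<Longrightarrow> x i \<in> C"
  shows "f (sum x I) = (\<Sum>i\<in>I. f (x i))"
proof -
  have "sum x I \<in> C \<and> f (sum x I) = (\<Sum>i\<in>I. f (x i))"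
    using assms(5) by (induction I rule: infinite_finite_induct) (auto simp: assms(1-4))
  then show ?thesis ..
qed

lemma kG_hom_compose:
  "kG_hom G L M f \<Longrightarrow> kG_hom G M N h \<Longrightarrow> kG_hom G L N (\<lambda>x. h (f x))"
  by (simp add: kG_hom_def)

lemma Sym_pow_simps [simp]:
  "carrier (Sym_pow V B s) = homog B s"
  "scal (Sym_pow V B s) = (\<lambda>c q. mconst c * q)"
  "act (Sym_pow V B s) = (\<lambda>g. msubst (\<lambda>b. sym_incl V B (act V g b)))"
  by (simp_all add: Sym_pow_def homog_def)

lemma kG_hom_Sym_sum:
  assumes "kG_hom G (Sym_pow V B s) (Sym_pow V B t) \<phi>" "\<And>i. i \<in> I \<Longrightarrow> x i \<in> homog B s"
  shows "\<phi> (sum x I) = (\<Sum>i\<in>I. \<phi> (x i))"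
proof (rule additive_on_sum[where C = "homog B s"])
  \<comment> \<open>The value at zero comes from compatibility with the scalar 0.\<close>
  have "\<phi> (mconst 0 * 0) = mconst 0 * \<phi> 0"
    using assms(1) unfolding kG_hom_def by (metis Sym_pow_simps(1,2) homog_zero)
  then show "\<phi> 0 = 0" by simp
qed (use assms in \<open>auto simp: kG_hom_def intro: homog_add\<close>)

text \<open>Since \<open>e\<close> is idempotent,
  \<open>(r + e)(a + d e) = a r + (a + d (r + 1)) e\<close>, and the two factors commute. Both
  orders of composition are recorded: a new section applies \<open>h\<close> first, a new retraction
  applies it last.\<close>

lemma idempotent_perturbation_inverse:
  fixes V :: "('g, 'k::field, 'v::ab_group_add) kG_structure"
  assumes e: "kG_hom G (Sym_pow V B s) (Sym_pow V B s) e"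
    and idem: "\<And>x. x \<in> homog B s \<Longrightarrow> e (e x) = e x"
    and r: "of_nat r \<noteq> (0::'k)" "of_nat (Suc r) \<noteq> (0::'k)"
  obtains h where "kG_hom G (Sym_pow V B s) (Sym_pow V B s) h"
    and "\<And>x. x \<in> homog B s \<Longrightarrow> h (of_nat r * x + e x) = x"
    and "\<And>x. x \<in> homog B s \<Longrightarrow> of_nat r * h x + e (h x) = x"
proof -
  \<comment> \<open>These solve \<open>a r = 1\<close> and \<open>a + d (r + 1) = 0\<close>. They
    are constant polynomials, because scalars act by multiplication in the polynomial ring.\<close>
  define a d :: "('v, 'k) mpoly" where "a = mconst (1 / of_nat r)"
    and "d = mconst (- 1 / (of_nat r * of_nat (Suc r)))"
  have ar: "a * of_nat r = 1"
    using r by (simp add: a_def flip: mconst_of_nat mconst_mult)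
  have "a + d * (of_nat r + 1) = mconst (1 / of_nat r + (- 1 / (of_nat r * of_nat (Suc r))) * of_nat (Suc r))"
    unfolding a_def d_def mconst_add mconst_mult mconst_of_nat by (simp add: add.commute)
  also have "1 / of_nat r + (- 1 / (of_nat r * of_nat (Suc r))) * of_nat (Suc r) = (0::'k)"
    using r by (simp add: field_simps del: of_nat_Suc)
  finally have ad: "a + d * (of_nat r + 1) = 0"
    by simp
  have e_mem: "e x \<in> homog B s" if "x \<in> homog B s" for x
    using e that by (simp add: kG_hom_def)
  have e_add: "e (x + y) = e x + e y" if "x \<in> homog B s" "y \<in> homog B s" for x y
    using e that by (simp add: kG_hom_def)
  have e_scale: "e (mconst c * x) = mconst c * e x" if "x \<in> homog B s" for c x
    using e that by (simp add: kG_hom_def)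
  define h where "h x = a * x + d * e x" for x
  show ?thesis
  proof
    show "kG_hom G (Sym_pow V B s) (Sym_pow V B s) h"
      unfolding kG_hom_def Sym_pow_simps
    proof (intro conjI ballI allI)
      show "h x \<in> homog B s" if "x \<in> homog B s" for x
        using that unfolding h_def a_def d_def by (intro homog_add homog_scale e_mem)
      show "h (x + y) = h x + h y" if "x \<in> homog B s" "y \<in> homog B s" for x y
        using that by (simp add: h_def e_add algebra_simps)
      show "h (mconst c * x) = mconst c * h x" if "x \<in> homog B s" for c x
        using that by (simp add: h_def e_scale distrib_left mult.left_commute)
      show "h (msubst (\<lambda>b. sym_incl V B (act V g b)) x)
          = msubst (\<lambda>b. sym_incl V B (act V g b)) (h x)"
        if "g \<in> carrier G" "x \<in> homog B s" for g x
        using that e by (simp add: h_def a_def d_def msubst_add msubst_mult kG_hom_def)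
    qed
    show "h (of_nat r * x + e x) = x" if x: "x \<in> homog B s" for x
    proof -
      have "e (of_nat r * x + e x) = (of_nat r + 1) * e x"
        using x by (simp add: e_add e_scale e_mem idem homog_scale distrib_right flip: mconst_of_nat)
      then have "h (of_nat r * x + e x) = (a * of_nat r) * x + (a + d * (of_nat r + 1)) * e x"
        by (simp add: h_def algebra_simps)
      then show ?thesis
        by (simp add: ar ad)
    qed
    show "of_nat r * h x + e (h x) = x" if x: "x \<in> homog B s" for x
    proof -
      have "e (h x) = a * e x + d * e x"
        using x by (simp add: h_def a_def d_def e_add e_scale e_mem idem homog_scale)
      then have "of_nat r * h x + e (h x) = (a * of_nat r) * x + (a + d * (of_nat r + 1)) * e x"
        by (simp add: h_def algebra_simps)
      then show ?thesis
        by (simp add: ar ad)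
    qed
  qed
qed

section \<open>Modules with a chosen finite basis\<close>

locale kG_module_basis =
  fixes G :: "('g, 'x) monoid_scheme"
    and V :: "('g, 'k::field, 'v::ab_group_add) kG_structure"
    and B :: "'v set"
  assumes module: "kG_module G V" and basis: "is_basis V B" and fin: "finite B"
begin

sublocale vector_space "scal V"
  using module by (simp add: kG_module_def)

abbreviation coord :: "'v \<Rightarrow> 'v \<Rightarrow> 'k" where
  "coord \<equiv> representation B"

abbreviation sact :: "'g \<Rightarrow> ('v, 'k) mpoly \<Rightarrow> ('v, 'k) mpoly" where
  "sact g \<equiv> msubst (\<lambda>b. sym_incl V B (act V g b))"

lemma indep: "independent B" and span_B: "span B = carrier V" and B_carrier: "B \<subseteq> carrier V"
  using basis by (auto simp: is_basis_def)

lemma carrier_add: "x \<in> carrier V \<Longrightarrow> y \<in> carrier V \<Longrightarrow> x + y \<in> carrier V"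
  and carrier_scale: "x \<in> carrier V \<Longrightarrow> scal V c x \<in> carrier V"
  and carrier_zero: "0 \<in> carrier V"
  using span_B span_add span_scale span_zero by metis+

lemma act_carrier: "g \<in> carrier G \<Longrightarrow> x \<in> carrier V \<Longrightarrow> act V g x \<in> carrier V"
  using module by (simp add: kG_module_def)

text \<open>The scalar action \<open>scale'\<close> of the target is left open: it is field
  multiplication for \<open>\<epsilon>\<close> and multiplication by constant polynomials for the
  inclusion of the module into its symmetric algebra.\<close>

lemma linear_on_coord:
  assumes "\<And>x y. x \<in> carrier V \<Longrightarrow> y \<in> carrier V \<Longrightarrow> f (x + y) = f x + f y"
    and scale: "\<And>c x. x \<in> carrier V \<Longrightarrow> f (scal V c x) = scale' c (f x)"
    and "f 0 = 0" and v: "v \<in> carrier V"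
  shows "f v = (\<Sum>b\<in>B. scale' (coord v b) (f b))"
proof -
  have "f v = f (\<Sum>b\<in>B. scal V (coord v b) b)"
    using sum_representation_eq[OF indep, of v B] v fin by (simp add: span_B)
  also have "\<dots> = (\<Sum>b\<in>B. f (scal V (coord v b) b))"
    using assms B_carrier by (intro additive_on_sum[where C = "carrier V"]) (auto intro: carrier_add carrier_zero carrier_scale)
  also have "\<dots> = (\<Sum>b\<in>B. scale' (coord v b) (f b))"
    using B_carrier by (intro sum.cong) (auto simp: scale)
  finally show ?thesis .
qed

lemma sym_incl_homog: "sym_incl V B v \<in> homog B 1"
  unfolding sym_incl_def by (intro homog_sum homog_scale homog_mvar)

lemma sact_homog: "q \<in> homog B s \<Longrightarrow> sact g q \<in> homog B s"
  by (erule homog_msubst) (rule sym_incl_homog)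

lemma mpderiv_sym_incl: "b \<in> B \<Longrightarrow> mpderiv b (sym_incl V B v) = mconst (coord v b)"
  using fin by (simp add: sym_incl_def mpderiv_sum mpderiv_mult mpderiv_mvar
      if_distrib[of "(*) _"] cong: if_cong)

text \<open>On basis vectors this is how \<open>sact g\<close> treats variables; linearity in
  \<open>v\<close> extends it to the whole carrier.\<close>

lemma sact_sym_incl:
  assumes g: "g \<in> carrier G" and v: "v \<in> carrier V"
  shows "sact g (sym_incl V B v) = sym_incl V B (act V g v)"
proof -
  let ?f = "\<lambda>v. sym_incl V B (act V g v)"
  have "?f v = (\<Sum>b\<in>B. mconst (coord v b) * ?f b)"
  proof (rule linear_on_coord)
    fix x y c assume x: "x \<in> carrier V"
    show "?f (scal V c x) = mconst c * ?f x"
      using g x module act_carrier[OF g x]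
      by (simp add: kG_module_def sym_incl_def representation_scale[OF indep] span_B mconst_mult
          sum_distrib_left mult_ac)
    show "?f (x + y) = ?f x + ?f y" if y: "y \<in> carrier V"
      using g x y module act_carrier[OF g x] act_carrier[OF g y]
      by (simp add: kG_module_def sym_incl_def representation_add[OF indep] span_B mconst_add
          sum.distrib distrib_right)
  next
    \<comment> \<open>That \<open>g\<close> fixes 0 follows from compatibility with the scalar
      0.\<close>
    have "act V g (scal V 0 0) = scal V 0 (act V g 0)"
      using g module carrier_zero unfolding kG_module_def by blast
    then show "?f 0 = 0"
      by (simp add: sym_incl_def representation_zero)
  qed (rule v)
  then show ?thesis
    by (simp add: sym_incl_def[of V B v] msubst_sum msubst_mult)
qed

text \<open>Chain rule for a linear substitution: the derivatives of the substituted linear forms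
  are the matrix entries of \<open>g\<close>.\<close>

lemma mpderiv_sact:
  assumes "q \<in> homog B s" "i \<in> B"
  shows "mpderiv i (sact g q) = (\<Sum>j\<in>B. mconst (coord (act V g j) i) * sact g (mpderiv j q))"
proof -
  have "\<forall>m\<in>Poly_Mapping.keys q. Poly_Mapping.keys m \<subseteq> B"
    using assms by (simp add: homog_def)
  then show ?thesis
    using assms(2) fin by (simp add: mpderiv_msubst mpderiv_sym_incl)
qed

section \<open>Polarization of a homomorphism between symmetric powers\<close>

definition polarize :: "(('v, 'k) mpoly \<Rightarrow> ('v, 'k) mpoly) \<Rightarrow> ('v, 'k) mpoly \<Rightarrow> ('v, 'k) mpoly" where
  "polarize \<phi> q = (\<Sum>b\<in>B. mvar b * \<phi> (mpderiv b q))"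

text \<open>Equivariance holds because the matrix of \<open>g\<close> that enters through the
  derivatives of \<open>sact g q\<close> is the one that expresses the images of the
  variables.\<close>

lemma kG_hom_polarize:
  assumes \<phi>: "kG_hom G (Sym_pow V B s) (Sym_pow V B t) \<phi>"
  shows "kG_hom G (Sym_pow V B (Suc s)) (Sym_pow V B (Suc t)) (polarize \<phi>)"
  unfolding kG_hom_def Sym_pow_simps
proof (intro conjI ballI allI)
  have \<phi>_mem: "\<phi> x \<in> homog B t" if "x \<in> homog B s" for x
    using \<phi> that by (simp add: kG_hom_def)
  have \<phi>_add: "\<phi> (x + y) = \<phi> x + \<phi> y" if "x \<in> homog B s" "y \<in> homog B s" for x y
    using \<phi> that by (simp add: kG_hom_def)
  have \<phi>_scale: "\<phi> (mconst c * x) = mconst c * \<phi> x" if "x \<in> homog B s" for c x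
    using \<phi> that by (simp add: kG_hom_def)
  have \<phi>_act: "\<phi> (sact g x) = sact g (\<phi> x)" if "g \<in> carrier G" "x \<in> homog B s" for g x
    using \<phi> that by (simp add: kG_hom_def)
  show "polarize \<phi> q \<in> homog B (Suc t)" if "q \<in> homog B (Suc s)" for q
    unfolding polarize_def
    using homog_mult[OF homog_mvar \<phi>_mem[OF homog_mpderiv[OF that]]] by (intro homog_sum) simp
  show "polarize \<phi> (p + q) = polarize \<phi> p + polarize \<phi> q"
    if "p \<in> homog B (Suc s)" "q \<in> homog B (Suc s)" for p q
    using that by (simp add: polarize_def mpderiv_add \<phi>_add homog_mpderiv distrib_left sum.distrib)
  show "polarize \<phi> (mconst c * q) = mconst c * polarize \<phi> q" if "q \<in> homog B (Suc s)" for c q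
    using that by (simp add: polarize_def mpderiv_mult \<phi>_scale homog_mpderiv sum_distrib_left mult_ac)
  show "polarize \<phi> (sact g q) = sact g (polarize \<phi> q)"
    if g: "g \<in> carrier G" and q: "q \<in> homog B (Suc s)" for g q
  proof -
    have "\<phi> (mpderiv i (sact g q))
        = (\<Sum>j\<in>B. mconst (coord (act V g j) i) * sact g (\<phi> (mpderiv j q)))" if "i \<in> B" for i
      unfolding mpderiv_sact[OF q that]
      by (subst kG_hom_Sym_sum[OF \<phi>])
        (simp_all add: homog_scale sact_homog homog_mpderiv[OF q] \<phi>_scale \<phi>_act[OF g])
    then have "polarize \<phi> (sact g q)
        = (\<Sum>i\<in>B. \<Sum>j\<in>B. mvar i * (mconst (coord (act V g j) i) * sact g (\<phi> (mpderiv j q))))"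
      by (simp add: polarize_def sum_distrib_left)
    \<comment> \<open>Summing over \<open>i\<close> first collects column \<open>j\<close> of the
      matrix into the image of the variable \<open>j\<close> under \<open>g\<close>.\<close>
    also have "\<dots> = (\<Sum>j\<in>B. sym_incl V B (act V g j) * sact g (\<phi> (mpderiv j q)))"
      by (subst sum.swap) (simp add: sym_incl_def sum_distrib_right mult_ac)
    also have "\<dots> = sact g (polarize \<phi> q)"
      by (simp add: polarize_def msubst_sum msubst_mult)
    finally show ?thesis .
  qed
qed

section \<open>Equivariance of the derivation and of the multiplication map\<close>

lemma kG_hom_sym_partial:
  assumes \<epsilon>: "kG_hom G V trivial_module \<epsilon>" "\<forall>b\<in>B. \<epsilon> b = 1"
  shows "kG_hom G (Sym_pow V B (Suc s)) (Sym_pow V B s) (sym_partial B)"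
  unfolding kG_hom_def Sym_pow_simps
proof (intro conjI ballI allI)
  show "sym_partial B q \<in> homog B s" if "q \<in> homog B (Suc s)" for q
    unfolding sym_partial_def by (intro homog_sum homog_mpderiv that)
  show "sym_partial B (p + q) = sym_partial B p + sym_partial B q" for p q :: "('v, 'k) mpoly"
    by (simp add: sym_partial_def mpderiv_add sum.distrib)
  show "sym_partial B (mconst c * q) = mconst c * sym_partial B q" for c and q :: "('v, 'k) mpoly"
    by (simp add: sym_partial_def mpderiv_mult sum_distrib_left)
  show "sym_partial B (sact g q) = sact g (sym_partial B q)"
    if g: "g \<in> carrier G" and q: "q \<in> homog B (Suc s)" for g q
  proof -
    \<comment> \<open>Each column of the matrix of \<open>g\<close> sums to 1, since
      \<open>\<epsilon>\<close> is invariant under \<open>g\<close> and equals 1 on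
      \<open>B\<close>. Summing the chain rule over \<open>i\<close> then leaves only the
      derivatives of \<open>q\<close>.\<close>
    have "(\<Sum>i\<in>B. coord (act V g j) i) = 1" if j: "j \<in> B" for j
    proof -
      have "\<epsilon> (act V g j) = (\<Sum>b\<in>B. coord (act V g j) b * \<epsilon> b)"
      proof (rule linear_on_coord)
        show "\<epsilon> (x + y) = \<epsilon> x + \<epsilon> y" if "x \<in> carrier V" "y \<in> carrier V" for x y
          using \<epsilon> that by (simp add: kG_hom_def)
        show sc: "\<epsilon> (scal V c x) = c * \<epsilon> x" if "x \<in> carrier V" for c x
          using \<epsilon> that by (simp add: kG_hom_def trivial_module_def)
        show "\<epsilon> 0 = 0"
          using sc[OF carrier_zero, of 0] by simp
        show "act V g j \<in> carrier V"
          using act_carrier g j B_carrier by blast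
      qed
      moreover have "\<epsilon> (act V g j) = \<epsilon> j"
        using \<epsilon>(1) g j B_carrier by (auto simp: kG_hom_def trivial_module_def)
      ultimately show ?thesis
        using \<epsilon>(2) j by simp
    qed
    then have "(\<Sum>j\<in>B. \<Sum>i\<in>B. mconst (coord (act V g j) i) * sact g (mpderiv j q))
        = (\<Sum>j\<in>B. sact g (mpderiv j q))"
      by (simp flip: sum_distrib_right mconst_sum)
    then show ?thesis
      unfolding sym_partial_def msubst_sum
      by (subst (asm) sum.swap) (simp add: mpderiv_sact[OF q])
  qed
qed

text \<open>The vector \<open>\<iota> 1\<close> is fixed by the group and \<open>sact g\<close> is
  multiplicative.\<close>

lemma kG_hom_sym_eta:
  assumes "kG_hom G trivial_module V \<iota>"
  shows "kG_hom G (Sym_pow V B s) (Sym_pow V B (Suc s)) (sym_eta V B \<iota>)"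
  unfolding kG_hom_def Sym_pow_simps
proof (intro conjI ballI allI)
  show "sym_eta V B \<iota> q \<in> homog B (Suc s)" if "q \<in> homog B s" for q
    using homog_mult[OF sym_incl_homog that] by (simp add: sym_eta_def)
  have "\<iota> 1 \<in> carrier V" "\<And>g. g \<in> carrier G \<Longrightarrow> act V g (\<iota> 1) = \<iota> 1"
    using assms by (auto simp: kG_hom_def trivial_module_def)
  then show "sym_eta V B \<iota> (sact g q) = sact g (sym_eta V B \<iota> q)" if "g \<in> carrier G" for g q
    using that by (simp add: sym_eta_def msubst_mult sact_sym_incl)
qed (simp_all add: sym_eta_def algebra_simps)

section \<open>Lifting a splitting to the next degree\<close>

lemma splits_surj_sym_partial_Suc:
  assumes \<epsilon>: "kG_hom G V trivial_module \<epsilon>" "\<forall>b\<in>B. \<epsilon> b = 1"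
    and r: "of_nat (Suc n) \<noteq> (0::'k)" "of_nat (Suc (Suc n)) \<noteq> (0::'k)"
    and split: "splits_surj G (Sym_pow V B (Suc n)) (Sym_pow V B n) (sym_partial B)"
  shows "splits_surj G (Sym_pow V B (Suc (Suc n))) (Sym_pow V B (Suc n)) (sym_partial B)"
proof -
  let ?D = "sym_partial B"
  obtain \<sigma> where \<sigma>: "kG_hom G (Sym_pow V B n) (Sym_pow V B (Suc n)) \<sigma>"
    and D\<sigma>: "\<And>y. y \<in> homog B n \<Longrightarrow> ?D (\<sigma> y) = y"
    using split by (auto simp: splits_surj_def)
  note D = kG_hom_sym_partial[OF \<epsilon>]
  have D_mem: "?D y \<in> homog B n" if "y \<in> homog B (Suc n)" for y :: "('v, 'k) mpoly"
    using D[of n] that by (simp add: kG_hom_def)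
  have polar: "?D (polarize \<sigma> y) = of_nat (Suc n) * y + \<sigma> (?D y)" if y: "y \<in> homog B (Suc n)" for y
  proof -
    \<comment> \<open>Leibniz rule, with derivative 1 for each variable in \<open>B\<close>. For
      \<open>f = \<sigma> (mpderiv b y)\<close> the second term simplifies because
      \<open>\<sigma>\<close> is a section.\<close>
    have D_mult: "?D (mvar b * f) = f + mvar b * ?D f" if "b \<in> B" for b and f :: "('v, 'k) mpoly"
      using that fin by (simp add: sym_partial_def mpderiv_mult mpderiv_mvar sum.distrib sum_distrib_left
          if_distrib[of "\<lambda>x. x * _"] cong: if_cong)
    have "?D (polarize \<sigma> y) = (\<Sum>b\<in>B. ?D (mvar b * \<sigma> (mpderiv b y)))"
      unfolding polarize_def sym_partial_def mpderiv_sum by (rule sum.swap)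
    also have "\<dots> = (\<Sum>b\<in>B. \<sigma> (mpderiv b y)) + (\<Sum>b\<in>B. mvar b * mpderiv b y)"
      using y by (simp add: D_mult D\<sigma> homog_mpderiv sum.distrib)
    also have "(\<Sum>b\<in>B. mvar b * mpderiv b y) = of_nat (Suc n) * y"
      by (rule euler_homogeneous[OF fin y])
    also have "(\<Sum>b\<in>B. \<sigma> (mpderiv b y)) = \<sigma> (?D y)"
      unfolding sym_partial_def using y by (intro kG_hom_Sym_sum[OF \<sigma>, symmetric] homog_mpderiv)
    finally show ?thesis
      by (simp add: add.commute)
  qed
  \<comment> \<open>The composite of \<open>?D\<close> followed by \<open>\<sigma>\<close> is
    idempotent, because \<open>?D (\<sigma> y) = y\<close>.\<close>
  obtain h where h: "kG_hom G (Sym_pow V B (Suc n)) (Sym_pow V B (Suc n)) h"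
    and inv: "\<And>x. x \<in> homog B (Suc n) \<Longrightarrow> of_nat (Suc n) * h x + \<sigma> (?D (h x)) = x"
    using idempotent_perturbation_inverse[OF kG_hom_compose[OF D \<sigma>] _ r] D\<sigma> D_mem by metis
  have "kG_hom G (Sym_pow V B (Suc n)) (Sym_pow V B (Suc (Suc n))) (\<lambda>y. polarize \<sigma> (h y))"
    by (rule kG_hom_compose[OF h kG_hom_polarize[OF \<sigma>]])
  moreover have "?D (polarize \<sigma> (h y)) = y" if "y \<in> homog B (Suc n)" for y
    using that h inv by (simp add: polar kG_hom_def del: of_nat_Suc)
  ultimately show ?thesis
    by (auto simp: splits_surj_def)
qed

lemma splits_inj_sym_eta_Suc:
  assumes \<iota>: "kG_hom G trivial_module V \<iota>"
    and r: "of_nat (Suc n) \<noteq> (0::'k)" "of_nat (Suc (Suc n)) \<noteq> (0::'k)"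
    and split: "splits_inj G (Sym_pow V B n) (Sym_pow V B (Suc n)) (sym_eta V B \<iota>)"
  shows "splits_inj G (Sym_pow V B (Suc n)) (Sym_pow V B (Suc (Suc n))) (sym_eta V B \<iota>)"
proof -
  let ?\<eta> = "sym_eta V B \<iota>"
  obtain \<rho> where \<rho>: "kG_hom G (Sym_pow V B (Suc n)) (Sym_pow V B n) \<rho>"
    and \<rho>\<eta>: "\<And>x. x \<in> homog B n \<Longrightarrow> \<rho> (?\<eta> x) = x"
    using split by (auto simp: splits_inj_def)
  note \<eta> = kG_hom_sym_eta[OF \<iota>]
  have \<eta>_mem: "?\<eta> x \<in> homog B (Suc s)" if "x \<in> homog B s" for x s
    using \<eta>[of s] that by (simp add: kG_hom_def)
  have \<rho>_mem: "\<rho> x \<in> homog B n" if "x \<in> homog B (Suc n)" for x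
    using \<rho> that by (simp add: kG_hom_def)
  have polar: "polarize \<rho> (?\<eta> x) = of_nat (Suc n) * x + ?\<eta> (\<rho> x)" if x: "x \<in> homog B (Suc n)" for x
  proof -
    \<comment> \<open>Differentiating the factor \<open>\<iota> 1\<close> gives its coordinate at
      \<open>b\<close>; in the other Leibniz term \<open>\<rho>\<close> cancels
      \<open>?\<eta>\<close>.\<close>
    have "\<rho> (mpderiv b (?\<eta> x)) = mconst (coord (\<iota> 1) b) * \<rho> x + mpderiv b x" if b: "b \<in> B" for b
    proof -
      have "mpderiv b (?\<eta> x) = mconst (coord (\<iota> 1) b) * x + ?\<eta> (mpderiv b x)"
        using b by (simp add: sym_eta_def mpderiv_mult mpderiv_sym_incl)
      moreover have "mconst (coord (\<iota> 1) b) * x \<in> homog B (Suc n)" "?\<eta> (mpderiv b x) \<in> homog B (Suc n)"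
        using x by (auto intro: homog_scale \<eta>_mem homog_mpderiv)
      ultimately show ?thesis
        using \<rho> x by (simp add: kG_hom_def \<rho>\<eta> homog_mpderiv)
    qed
    \<comment> \<open>The coordinates reassemble to the linear form of \<open>\<iota> 1\<close>, so
      the first sum is \<open>?\<eta> (\<rho> x)\<close>; the second is Euler's identity.\<close>
    then have "polarize \<rho> (?\<eta> x)
        = (\<Sum>b\<in>B. mconst (coord (\<iota> 1) b) * mvar b) * \<rho> x + (\<Sum>b\<in>B. mvar b * mpderiv b x)"
      by (simp add: polarize_def algebra_simps sum.distrib sum_distrib_left)
    then show ?thesis
      unfolding euler_homogeneous[OF fin x] by (simp add: sym_eta_def sym_incl_def)
  qed
  obtain h where h: "kG_hom G (Sym_pow V B (Suc n)) (Sym_pow V B (Suc n)) h"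
    and inv: "\<And>x. x \<in> homog B (Suc n) \<Longrightarrow> h (of_nat (Suc n) * x + ?\<eta> (\<rho> x)) = x"
    using idempotent_perturbation_inverse[OF kG_hom_compose[OF \<rho> \<eta>] _ r] \<rho>\<eta> \<rho>_mem by metis
  have "kG_hom G (Sym_pow V B (Suc (Suc n))) (Sym_pow V B (Suc n)) (\<lambda>x. h (polarize \<rho> x))"
    by (rule kG_hom_compose[OF kG_hom_polarize[OF \<rho>] h])
  moreover have "h (polarize \<rho> (?\<eta> x)) = x" if "x \<in> homog B (Suc n)" for x
    using that inv by (simp add: polar del: of_nat_Suc)
  ultimately show ?thesis
    by (auto simp: splits_inj_def)
qed

end

section \<open>Arbitrary bases of a finite-dimensional module\<close>

lemma is_basis_finite:
  assumes "kG_module G V" "fin_dim V" "is_basis V B"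
  shows "finite B"
proof -
  interpret vector_space "scal V"
    using assms(1) by (simp add: kG_module_def)
  obtain C where "finite C" "is_basis V C"
    using assms(2) by (auto simp: fin_dim_def)
  \<comment> \<open>An independent set inside the span of the finite set \<open>C\<close> is
    finite.\<close>
  then show ?thesis
    using assms(3) independent_span_bound[of C B] by (auto simp: is_basis_def)
qed

theorem theorem1p1:
  fixes p r :: nat
    and G :: "('g, 'x) monoid_scheme"
    and V :: "('g, 'k::field, 'v::ab_group_add) kG_structure"
  assumes "prime p" and "CHAR('k) = p"
    and "group G" and "finite (carrier G)"
    and "kG_module G V" and "fin_dim V"
    and "r > 0"
    and "[int r \<noteq> 0] (mod int p)" and "[int r \<noteq> -1] (mod int p)"
  shows "(\<forall>\<epsilon> B. kG_hom G V trivial_module \<epsilon> \<and> \<epsilon> ` carrier V = UNIV \<and>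
            is_basis V B \<and> (\<forall>b\<in>B. \<epsilon> b = 1) \<longrightarrow>
            splits_surj G (Sym_pow V B r) (Sym_pow V B (r - 1)) (sym_partial B) \<longrightarrow>
            splits_surj G (Sym_pow V B (r + 1)) (Sym_pow V B r) (sym_partial B))
       \<and> (\<forall>\<iota> B. kG_hom G trivial_module V \<iota> \<and> inj \<iota> \<and> is_basis V B \<longrightarrow>
            splits_inj G (Sym_pow V B (r - 1)) (Sym_pow V B r) (sym_eta V B \<iota>) \<longrightarrow>
            splits_inj G (Sym_pow V B r) (Sym_pow V B (r + 1)) (sym_eta V B \<iota>))"
proof -
  \<comment> \<open>Writing \<open>r\<close> as a successor turns the truncated \<open>r - 1\<close>
    into \<open>n\<close>.\<close>
  obtain n where n: "r = Suc n"
    using \<open>r > 0\<close> by (cases r) auto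
  \<comment> \<open>The two congruence conditions say that \<open>p\<close> divides neither
    \<open>r\<close> nor \<open>r + 1\<close>; in characteristic \<open>p\<close> both are therefore
    nonzero scalars.\<close>
  have "\<not> p dvd r"
    using assms(8) by (simp add: cong_0_iff)
  moreover have "\<not> p dvd Suc r"
    using assms(9) by (simp add: cong_iff_dvd_diff add.commute flip: int_dvd_int_iff)
  ultimately have r: "of_nat (Suc n) \<noteq> (0::'k)" "of_nat (Suc (Suc n)) \<noteq> (0::'k)"
    using assms(2) n by (simp_all add: of_nat_eq_0_iff_char_dvd del: of_nat_Suc)
  have "kG_module_basis G V B" if "is_basis V B" for B
    using that assms is_basis_finite by unfold_locales auto
  then show ?thesis
    unfolding n by (auto intro: kG_module_basis.splits_surj_sym_partial_Suc[OF _ _ _ r]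
      kG_module_basis.splits_inj_sym_eta_Suc[OF _ _ r])
qed

end
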